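(* For any graphs $G$ and $J$ (not necessarily connected), $c_H(G \vee J) \leq \Upsilon(G) + \Upsilon(J)$.
   Context: The join $G \vee J$ has vertex set $V(G) \cup V(J)$ (disjoint union) and edge set $E(G) \cup E(J) \cup \{uv : u \in V(G), v \in V(J)\}$; it is connected. Hyperopic Cops and Robber on a graph $H$ (each vertex considered to carry a loop, so a player may stay put): the cops first occupy a multiset of vertices, then the robber chooses a vertex. In each round, each cop moves to an adjacent vertex or stays, then the robber moves to an adjacent vertex or stays. The robber always sees all cops. The cops see the robber's position except when the robber's vertex is adjacent to every vertex occupied by a cop, in which case the robber is invisible. The robber is captured when a cop occupies the robber's vertex. $c_H(H)$ is the minimum number of cops that can guarantee capture in finitely many moves. $N(v)$ denotes the open neighbourhood of $v$. A non-empty set $S \subseteq V(G)$ is a small common neighbourhood set of $G$ if $\left|\bigcap_{v\in S} N_G(v)\right| \le |S|$; $\Upsilon(G)$ is the minimum cardinality of such a set. *)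

theory Defs
  imports "Graph_Theory.Graph_Theory"
begin

text \<open>
  Finite simple graphs are the \<^locale>\<open>pair_graph\<close>s of the AFP entry Graph\_Theory: a finite
  vertex set \<^const>\<open>pverts\<close> with a symmetric, irreflexive arc relation \<^const>\<open>parcs\<close>. An
  undirected edge is the pair of its two orientations, and adjacency is \<open>u \<rightarrow>\<^bsub>G\<^esub> v\<close>.
\<close>

definition graph_join :: "'a pair_pre_digraph \<Rightarrow> 'b pair_pre_digraph \<Rightarrow> ('a + 'b) pair_pre_digraph"
  where
  "graph_join G J = \<lparr>
     pverts = pverts G <+> pverts J,
     parcs = {(Inl u, Inl v) | u v. (u, v) \<in> parcs G} \<union>
             {(Inr u, Inr v) | u v. (u, v) \<in> parcs J} \<union>
             {(Inl u, Inr v) | u v. u \<in> pverts G \<and> v \<in> pverts J} \<union>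
             {(Inr v, Inl u) | u v. u \<in> pverts G \<and> v \<in> pverts J} \<rparr>"

lemma pair_graph_graph_join:
  assumes "pair_graph G" and "pair_graph J"
  shows "pair_graph (graph_join G J)"
proof -
  interpret G: pair_graph G by fact
  interpret J: pair_graph J by fact
  have sub: "parcs (graph_join G J) \<subseteq> pverts (graph_join G J) \<times> pverts (graph_join G J)"
    by (auto simp: graph_join_def dest: G.in_arcsD1 G.in_arcsD2 J.in_arcsD1 J.in_arcsD2)
  have fin: "finite (pverts (graph_join G J))"
    by (simp add: graph_join_def G.pair_finite_verts J.pair_finite_verts)
  have "finite (parcs (graph_join G J))"
    using sub fin by (meson finite_SigmaI finite_subset)
  moreover have "symmetric (with_proj (graph_join G J))"
    by (auto simp: symmetric_def sym_def graph_join_def dest: G.arcs_symmetric J.arcs_symmetric)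
  moreover have "\<And>e. e \<in> parcs (graph_join G J) \<Longrightarrow> fst e \<noteq> snd e"
    by (auto simp: graph_join_def dest: G.no_loops' J.no_loops')
  ultimately show ?thesis
    using sub fin by unfold_locales auto
qed

definition nbhd :: "'a pair_pre_digraph \<Rightarrow> 'a \<Rightarrow> 'a set" where
  "nbhd G v = {u. v \<rightarrow>\<^bsub>G\<^esub> u}"

definition small_common_nbhd_set :: "'a pair_pre_digraph \<Rightarrow> 'a set \<Rightarrow> bool" where
  "small_common_nbhd_set G S \<longleftrightarrow>
     S \<noteq> {} \<and> S \<subseteq> pverts G \<and> card (\<Inter>v\<in>S. nbhd G v) \<le> card S"

definition Upsilon :: "'a pair_pre_digraph \<Rightarrow> nat" where
  "Upsilon G = (LEAST n. \<exists>S. small_common_nbhd_set G S \<and> card S = n)"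

text \<open>The minimum in \<^const>\<open>Upsilon\<close> exists: the whole vertex set qualifies.\<close>

lemma small_common_nbhd_set_pverts:
  assumes "pair_graph G" and "pverts G \<noteq> {}"
  shows "small_common_nbhd_set G (pverts G)"
proof -
  interpret pair_graph G by fact
  have "(\<Inter>v\<in>pverts G. nbhd G v) = {}"
    using assms(2) by (auto simp: nbhd_def dest: no_loops' in_arcsD2)
  then show ?thesis
    using assms(2) by (simp add: small_common_nbhd_set_def)
qed


text \<open>
  Hyperopic Cops and Robber. A position of \<open>k\<close> cops is a list of \<open>k\<close> vertices, with repetitions
  allowed. Staying put is a legal move (the loops of the game live in \<open>move\<close>, not in the graph).
\<close>

definition move :: "'a pair_pre_digraph \<Rightarrow> 'a \<Rightarrow> 'a \<Rightarrow> bool" where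
  "move H u v \<longleftrightarrow> u = v \<or> u \<rightarrow>\<^bsub>H\<^esub> v"

text \<open>What cops at \<open>C\<close> see of a robber at \<open>v\<close>; \<^const>\<open>None\<close> means that he is invisible.\<close>

definition view :: "'a pair_pre_digraph \<Rightarrow> 'a list \<Rightarrow> 'a \<Rightarrow> 'a option" where
  "view H C v = (if \<forall>c \<in> set C. v \<rightarrow>\<^bsub>H\<^esub> c then None else Some v)"

text \<open>
  A deterministic cop strategy maps what the cops have seen so far to their next position. What
  they have seen is a list with one entry for each turn of the robber so far, consisting of their
  views just before and just after that turn. Their own earlier positions are not listed, since
  they are the values of the strategy on the prefixes of the list. The value at \<open>[]\<close> is the initial
  placement.
\<close>

type_synonym 'a cop_strategy = "('a option \<times> 'a option) list \<Rightarrow> 'a list"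

definition legal_cop_strategy :: "'a pair_pre_digraph \<Rightarrow> nat \<Rightarrow> 'a cop_strategy \<Rightarrow> bool" where
  "legal_cop_strategy H k \<sigma> \<longleftrightarrow>
     (\<forall>h. length (\<sigma> h) = k \<and> set (\<sigma> h) \<subseteq> pverts H) \<and>
     (\<forall>h e. list_all2 (move H) (\<sigma> h) (\<sigma> (h @ [e])))"

text \<open>
  The robber's trajectory: \<open>r 0\<close> is his initial vertex, \<open>r t\<close> his vertex after round \<open>t\<close>. As cop
  strategies are deterministic, quantifying over all trajectories is the same as quantifying over
  all strategies of a robber who sees the cops.
\<close>

definition legal_robber_play :: "'a pair_pre_digraph \<Rightarrow> (nat \<Rightarrow> 'a) \<Rightarrow> bool" where
  "legal_robber_play H r \<longleftrightarrow> r 0 \<in> pverts H \<and> (\<forall>t. move H (r t) (r (Suc t)))"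

text \<open>
  \<open>seen H \<sigma> r t\<close> is what the cops have seen before their move in round \<open>t\<close> (for \<open>t = 0\<close>: before
  their placement), so \<open>\<sigma> (seen H \<sigma> r t)\<close> is their position after that move. Before the robber's
  turn \<open>0\<close>, his placement, there is nothing to see, and \<^const>\<open>None\<close> is recorded.
\<close>

primrec seen ::
  "'a pair_pre_digraph \<Rightarrow> 'a cop_strategy \<Rightarrow> (nat \<Rightarrow> 'a) \<Rightarrow> nat \<Rightarrow> ('a option \<times> 'a option) list"
  where
  "seen H \<sigma> r 0 = []"
| "seen H \<sigma> r (Suc t) = seen H \<sigma> r t @
     [(case t of 0 \<Rightarrow> None | Suc s \<Rightarrow> view H (\<sigma> (seen H \<sigma> r t)) (r s),
       view H (\<sigma> (seen H \<sigma> r t)) (r t))]"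

text \<open>
  Capture may happen on the robber's turn \<open>t\<close> or on the cops' move in round \<open>Suc t\<close>. Plays are
  formally continued after a capture; this has no effect on who wins.
\<close>

definition captured :: "'a pair_pre_digraph \<Rightarrow> 'a cop_strategy \<Rightarrow> (nat \<Rightarrow> 'a) \<Rightarrow> bool" where
  "captured H \<sigma> r \<longleftrightarrow>
     (\<exists>t. r t \<in> set (\<sigma> (seen H \<sigma> r t)) \<or> r t \<in> set (\<sigma> (seen H \<sigma> r (Suc t))))"

definition cops_win :: "'a pair_pre_digraph \<Rightarrow> nat \<Rightarrow> bool" where
  "cops_win H k \<longleftrightarrow>
     (\<exists>\<sigma>. legal_cop_strategy H k \<sigma> \<and> (\<forall>r. legal_robber_play H r \<longrightarrow> captured H \<sigma> r))"

definition hyperopic_cop_number :: "'a pair_pre_digraph \<Rightarrow> nat" where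
  "hyperopic_cop_number H = (LEAST k. cops_win H k)"

text \<open>The minimum in \<^const>\<open>hyperopic_cop_number\<close> exists: one cop on each vertex wins.\<close>

lemma cops_win_card_pverts:
  assumes "pair_graph H"
  shows "cops_win H (card (pverts H))"
proof -
  interpret pair_graph H by fact
  obtain xs where xs: "set xs = pverts H" "length xs = card (pverts H)"
    using pair_finite_verts by (metis finite_distinct_list distinct_card)
  have "legal_cop_strategy H (card (pverts H)) (\<lambda>_. xs)"
    using xs by (simp add: legal_cop_strategy_def move_def list_all2_same)
  moreover have "captured H (\<lambda>_. xs) r" if "legal_robber_play H r" for r
    using that xs by (auto simp: legal_robber_play_def captured_def)
  ultimately show ?thesis
    unfolding cops_win_def by blast
qed

end

theory Submission
  imports Defs
begin

text \<open>
  Place cops on small common neighbourhood sets \<open>S\<close> of \<open>G\<close> and \<open>T\<close> of \<open>J\<close>. They win with their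
  first move. A visible robber in one of the two graphs is adjacent to every cop in the other one.
  An invisible robber is in the common neighbourhood of \<open>S\<close> in \<open>G\<close> or of \<open>T\<close> in \<open>J\<close>, and these
  sets are small enough to be occupied completely by the cops from \<open>S\<close> and from \<open>T\<close>.
\<close>

lemma Upsilon_attained:
  assumes "pair_graph G" and "pverts G \<noteq> {}"
  obtains S where "small_common_nbhd_set G S" and "card S = Upsilon G"
proof -
  have "\<exists>n S. small_common_nbhd_set G S \<and> card S = n"
    using small_common_nbhd_set_pverts[OF assms] by blast
  then have "\<exists>S. small_common_nbhd_set G S \<and> card S = Upsilon G"
    unfolding Upsilon_def by (rule LeastI_ex)
  then show thesis
    using that by blast
qed

text \<open>Since every entry of \<open>xs\<close> may move to every element of \<open>A\<close>, no
  matching argument is needed: the first \<open>card A\<close> entries go to the elements of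
  \<open>A\<close> in any enumeration, and the others stay put.\<close>

lemma move_into_set:
  assumes "finite A" and "card A \<le> length xs"
    and "\<And>x a. x \<in> set xs \<Longrightarrow> a \<in> A \<Longrightarrow> move H x a"
  obtains ys where "list_all2 (move H) xs ys" and "A \<subseteq> set ys"
proof -
  obtain zs where zs: "set zs = A" "length zs = card A"
    using assms(1) by (metis finite_distinct_list distinct_card)
  have "list_all2 (move H) (take (length zs) xs) zs"
    using zs assms(2,3) by (force simp: list_all2_conv_all_nth)
  moreover have "list_all2 (move H) (drop (length zs) xs) (drop (length zs) xs)"
    by (simp add: list_all2_same move_def)
  ultimately have "list_all2 (move H) xs (zs @ drop (length zs) xs)"
    using list_all2_appendI by fastforce
  then show thesis
    using that zs(1) by simp
qed

text \<open>This reduces the game to one reply per view. The robber's starting vertex is known only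
  up to the view \<open>w\<close>, so the reply \<open>ys\<close> must cover every vertex with that
  view.\<close>

lemma cops_win_in_one_move:
  fixes H :: "'a pair_pre_digraph"
  assumes "pair_graph H" and "set xs \<subseteq> pverts H"
    and answer: "\<And>w. \<exists>ys. list_all2 (move H) xs ys \<and>
      (\<forall>v \<in> pverts H. view H xs v = w \<longrightarrow> v \<in> set ys)"
  shows "cops_win H (length xs)"
proof -
  interpret pair_graph H by fact
  from answer obtain f where f: "\<And>w. list_all2 (move H) xs (f w)"
    "\<And>w v. v \<in> pverts H \<Longrightarrow> view H xs v = w \<Longrightarrow> v \<in> set (f w)"
    by metis
  have f_verts: "set (f w) \<subseteq> pverts H" for w
  proof
    fix y
    assume "y \<in> set (f w)"
    then obtain x where "x \<in> set xs" "move H x y"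
      using f(1)[of w] by (metis in_set_conv_nth list_all2_conv_all_nth)
    then show "y \<in> pverts H"
      using assms(2) by (auto simp: move_def dest: in_arcsD2)
  qed
  \<comment> \<open>The second component of \<open>hd h\<close> is the view just after the robber's
    placement. Later entries do not change the head, so after their first move the cops stay put,
    which keeps the strategy legal.\<close>
  define \<sigma> :: "'a cop_strategy" where "\<sigma> h = (if h = [] then xs else f (snd (hd h)))" for h
  have "legal_cop_strategy H (length xs) \<sigma>"
    using assms(2) f(1) f_verts f(1)[THEN list_all2_lengthD]
    by (auto simp: legal_cop_strategy_def \<sigma>_def list_all2_same move_def)
  moreover have "captured H \<sigma> r" if "legal_robber_play H r" for r
  proof -
    \<comment> \<open>The cops' first move catches the robber while he is still at
      \<open>r 0\<close>.\<close>
    have "r 0 \<in> set (\<sigma> (seen H \<sigma> r (Suc 0)))"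
      using that f(2) by (simp add: \<sigma>_def legal_robber_play_def)
    then show ?thesis
      unfolding captured_def by blast
  qed
  ultimately show ?thesis
    unfolding cops_win_def by blast
qed

lemma cops_win_graph_join:
  assumes "pair_graph G" and "pair_graph J"
    and S: "small_common_nbhd_set G S" and T: "small_common_nbhd_set J T"
  shows "cops_win (graph_join G J) (card S + card T)"
proof -
  interpret G: pair_graph G by fact
  interpret J: pair_graph J by fact
  let ?H = "graph_join G J"
  let ?A = "\<Inter>v\<in>S. nbhd G v" and ?B = "\<Inter>v\<in>T. nbhd J v"
  have S': "S \<noteq> {}" "S \<subseteq> pverts G" "card ?A \<le> card S" "finite S"
    and T': "T \<noteq> {}" "T \<subseteq> pverts J" "card ?B \<le> card T" "finite T"
    using S T G.pair_finite_verts J.pair_finite_verts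
    by (auto simp: small_common_nbhd_set_def intro: finite_subset)
  have "?A \<subseteq> pverts G" "?B \<subseteq> pverts J"
    using S'(1) T'(1) by (auto simp: nbhd_def dest: G.in_arcsD2 J.in_arcsD2)
  then have fin: "finite ?A" "finite ?B"
    using G.pair_finite_verts J.pair_finite_verts by (auto intro: finite_subset)
  obtain ss ts where ss: "set ss = S" "length ss = card S" and ts: "set ts = T" "length ts = card T"
    using S'(4) T'(4) by (metis finite_distinct_list distinct_card)
  define ls where "ls = map (Inl :: _ \<Rightarrow> 'a + 'b) ss"
  define rs where "rs = map (Inr :: _ \<Rightarrow> 'a + 'b) ts"
  have set_lr: "set ls = Inl ` S" "set rs = Inr ` T"
    and len_lr: "length ls = card S" "length rs = card T"
    using ss ts by (simp_all add: ls_def rs_def)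
  have stay: "list_all2 (move ?H) zs zs" for zs
    by (simp add: list_all2_same move_def)
  \<comment> \<open>Each side has at least one cop to send to a visible robber on the other
    side.\<close>
  have card_pos: "Suc 0 \<le> card S" "Suc 0 \<le> card T"
    using S' T' by (simp_all add: Suc_le_eq card_gt_0_iff)
  have "\<exists>ys. list_all2 (move ?H) (ls @ rs) ys \<and>
      (\<forall>v \<in> pverts ?H. view ?H (ls @ rs) v = w \<longrightarrow> v \<in> set ys)" for w
  proof (cases w)
    case None
    \<comment> \<open>Being adjacent to the cops on the robber's own side puts him in
      \<open>?A\<close> or \<open>?B\<close>. Symmetry is used because \<open>view\<close> takes
      arcs leaving the robber, \<open>nbhd\<close> arcs entering him.\<close>
    have invisible: "v \<in> Inl ` ?A \<union> Inr ` ?B" if "view ?H (ls @ rs) v = w" for v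
    proof -
      have "v \<rightarrow>\<^bsub>?H\<^esub> c" if "c \<in> Inl ` S \<union> Inr ` T" for c
        using \<open>view ?H (ls @ rs) v = w\<close> that None by (auto simp: view_def set_lr split: if_splits)
      then have "Inl x \<in> Inl ` S \<Longrightarrow> v \<rightarrow>\<^bsub>?H\<^esub> Inl x" "Inr y \<in> Inr ` T \<Longrightarrow> v \<rightarrow>\<^bsub>?H\<^esub> Inr y" for x y
        by blast+
      then show ?thesis
        by (cases v)
          (auto simp: graph_join_def nbhd_def image_iff intro: G.arcs_symmetric J.arcs_symmetric)
    qed
    \<comment> \<open>A common neighbour of \<open>S\<close> can be reached by every cop on
      \<open>S\<close>, and \<open>card ?A \<le> card S\<close> provides enough cops.\<close>
    obtain ls' where ls': "list_all2 (move ?H) ls ls'" "Inl ` ?A \<subseteq> set ls'"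
      by (rule move_into_set[of "Inl ` ?A" ls ?H])
        (use fin S' in \<open>auto simp: len_lr set_lr card_image move_def graph_join_def nbhd_def\<close>)
    obtain rs' where rs': "list_all2 (move ?H) rs rs'" "Inr ` ?B \<subseteq> set rs'"
      by (rule move_into_set[of "Inr ` ?B" rs ?H])
        (use fin T' in \<open>auto simp: len_lr set_lr card_image move_def graph_join_def nbhd_def\<close>)
    have "list_all2 (move ?H) (ls @ rs) (ls' @ rs')"
      using ls'(1) rs'(1) by (rule list_all2_appendI)
    then show ?thesis
      using invisible ls'(2) rs'(2) by (intro exI[of _ "ls' @ rs'"]) fastforce
  next
    case (Some u)
    have visible: "v = u" if "view ?H (ls @ rs) v = w" for v
      using that Some by (auto simp: view_def split: if_splits)
    consider g where "u = Inl g" "g \<in> pverts G" | j where "u = Inr j" "j \<in> pverts J"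
      | "u \<notin> pverts ?H"
      by (auto simp: graph_join_def)
    then show ?thesis
    proof cases
      \<comment> \<open>A join edge leads from any cop on \<open>T\<close> to \<open>u\<close>,
        while the cops on \<open>S\<close> stay.\<close>
      case 1
      then obtain rs' where "list_all2 (move ?H) rs rs'" "{u} \<subseteq> set rs'"
        using move_into_set[of "{u}" rs ?H] T'(2) card_pos
        by (force simp: len_lr set_lr move_def graph_join_def)
      then show ?thesis
        using visible by (intro exI[of _ "ls @ rs'"]) (auto intro: list_all2_appendI stay)
    next
      case 2
      then obtain ls' where "list_all2 (move ?H) ls ls'" "{u} \<subseteq> set ls'"
        using move_into_set[of "{u}" ls ?H] S'(2) card_pos
        by (force simp: len_lr set_lr move_def graph_join_def)
      then show ?thesis
        using visible by (intro exI[of _ "ls' @ rs"]) (auto intro: list_all2_appendI stay)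
    next
      \<comment> \<open>No vertex of the join has this view, so any reply will do.\<close>
      case 3
      then show ?thesis
        using visible stay by blast
    qed
  qed
  moreover have "set (ls @ rs) \<subseteq> pverts ?H"
    using S'(2) T'(2) by (auto simp: set_lr graph_join_def)
  ultimately have "cops_win ?H (length (ls @ rs))"
    using cops_win_in_one_move[OF pair_graph_graph_join[OF assms(1,2)]] by blast
  then show ?thesis
    by (simp add: len_lr)
qed

theorem theorem4p2:
  fixes G :: "'a pair_pre_digraph" and J :: "'b pair_pre_digraph"
  assumes "pair_graph G" and "pverts G \<noteq> {}"
    and "pair_graph J" and "pverts J \<noteq> {}"
  shows "hyperopic_cop_number (graph_join G J) \<le> Upsilon G + Upsilon J"
proof -
  obtain S T where "small_common_nbhd_set G S" "card S = Upsilon G"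
    and "small_common_nbhd_set J T" "card T = Upsilon J"
    using Upsilon_attained assms by metis
  then have "cops_win (graph_join G J) (Upsilon G + Upsilon J)"
    using cops_win_graph_join[of G J S T] assms by simp
  then show ?thesis
    unfolding hyperopic_cop_number_def by (rule Least_le)
qed

end
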